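(* There exist infinitely many bipartite IC-planar graphs $G$ such that, with $n$ denoting the number of vertices of $G$, $G$ has exactly $2.25n-4$ edges.
   Context: Graphs are drawn as topological graphs: vertices are distinct points of the plane and edges are Jordan arcs joining their endpoints, such that no edge passes through a vertex other than its endpoints, no two adjacent edges cross, no edge crosses itself, no two edges meet tangentially, and any two edges cross at most once. A graph is IC-planar if it admits such a drawing in which every edge is crossed at most once and crossings are independent, i.e., no two crossing pairs of edges share an endpoint (each vertex is incident to at most one crossed edge). *)

theory Defs
  imports "HOL-Analysis.Analysis"
begin

section \<open>Finite simple graphs\<close>

type_synonym 'a graph = "'a set \<times> 'a set set"

abbreviation verts :: "'a graph \<Rightarrow> 'a set" where "verts \<equiv> fst"
abbreviation edges :: "'a graph \<Rightarrow> 'a set set" where "edges \<equiv> snd"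

definition simple_graph :: "'a graph \<Rightarrow> bool" where
  "simple_graph G \<longleftrightarrow> finite (verts G) \<and> (\<forall>e \<in> edges G. e \<subseteq> verts G \<and> card e = 2)"

definition graph_iso :: "'a graph \<Rightarrow> 'b graph \<Rightarrow> bool" where
  "graph_iso G H \<longleftrightarrow>
     (\<exists>f. bij_betw f (verts G) (verts H) \<and> edges H = (\<lambda>e. f ` e) ` edges G)"

definition bipartite :: "'a graph \<Rightarrow> bool" where
  "bipartite G \<longleftrightarrow>
     (\<exists>A B. A \<inter> B = {} \<and> A \<union> B = verts G \<and> (\<forall>e \<in> edges G. \<exists>a \<in> A. \<exists>b \<in> B. e = {a, b}))"


section \<open>Drawings in the plane\<close>

definition arc_interior :: "(real \<Rightarrow> complex) \<Rightarrow> complex set" where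
  "arc_interior g = path_image g - {pathstart g, pathfinish g}"

text \<open>
  Two arcs cross at an interior point \<open>p\<close> if a local change of coordinates around \<open>p\<close> turns them
  into the two coordinate axes. The other way to meet at a common interior point is to touch
  (to meet tangentially); as arcs are only continuous, this is a topological notion.
\<close>

definition cross_at :: "(real \<Rightarrow> complex) \<Rightarrow> (real \<Rightarrow> complex) \<Rightarrow> complex \<Rightarrow> bool" where
  "cross_at g h p \<longleftrightarrow>
     p \<in> arc_interior g \<and> p \<in> arc_interior h \<and>
     (\<exists>U \<phi> \<psi>. open U \<and> p \<in> U \<and> homeomorphism U (ball 0 1) \<phi> \<psi> \<and> \<phi> p = 0 \<and>
        \<phi> ` (U \<inter> path_image g) = {z \<in> ball (0 :: complex) 1. Im z = 0} \<and>
        \<phi> ` (U \<inter> path_image h) = {z \<in> ball (0 :: complex) 1. Re z = 0})"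

text \<open>
  The edge \<open>e\<close> is drawn as the arc \<open>c e\<close>, whose orientation is irrelevant. That no edge crosses
  itself is part of \<open>arc\<close>, which requires injectivity.
\<close>

definition drawing :: "'a graph \<Rightarrow> ('a \<Rightarrow> complex) \<Rightarrow> ('a set \<Rightarrow> real \<Rightarrow> complex) \<Rightarrow> bool" where
  "drawing G pos c \<longleftrightarrow>
     inj_on pos (verts G) \<and>
     (\<forall>e \<in> edges G. arc (c e) \<and> {pathstart (c e), pathfinish (c e)} = pos ` e) \<and>
     (\<forall>e \<in> edges G. \<forall>v \<in> verts G. pos v \<in> path_image (c e) \<longrightarrow> v \<in> e) \<and>
     (\<forall>e \<in> edges G. \<forall>f \<in> edges G. e \<noteq> f \<and> e \<inter> f \<noteq> {} \<longrightarrow> (\<nexists>p. cross_at (c e) (c f) p)) \<and>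
     (\<forall>e \<in> edges G. \<forall>f \<in> edges G. e \<noteq> f \<longrightarrow>
        (\<forall>p \<in> arc_interior (c e) \<inter> arc_interior (c f). cross_at (c e) (c f) p)) \<and>
     (\<forall>e \<in> edges G. \<forall>f \<in> edges G. e \<noteq> f \<longrightarrow>
        (\<forall>p q. cross_at (c e) (c f) p \<and> cross_at (c e) (c f) q \<longrightarrow> p = q))"

definition crossing_pair :: "'a graph \<Rightarrow> ('a set \<Rightarrow> real \<Rightarrow> complex) \<Rightarrow> 'a set \<Rightarrow> 'a set \<Rightarrow> bool" where
  "crossing_pair G c e f \<longleftrightarrow>
     e \<in> edges G \<and> f \<in> edges G \<and> e \<noteq> f \<and> (\<exists>p. cross_at (c e) (c f) p)"

text \<open>
  In a drawing two edges cross at most once, so an edge is crossed at most once if and only if it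
  crosses at most one other edge.
\<close>

definition ic_planar_drawing ::
    "'a graph \<Rightarrow> ('a \<Rightarrow> complex) \<Rightarrow> ('a set \<Rightarrow> real \<Rightarrow> complex) \<Rightarrow> bool" where
  "ic_planar_drawing G pos c \<longleftrightarrow>
     drawing G pos c \<and>
     (\<forall>e f f'. crossing_pair G c e f \<and> crossing_pair G c e f' \<longrightarrow> f = f') \<and>
     (\<forall>e f e' f'. crossing_pair G c e f \<and> crossing_pair G c e' f' \<and> {e, f} \<noteq> {e', f'} \<longrightarrow>
        (e \<union> f) \<inter> (e' \<union> f') = {})"

definition ic_planar :: "'a graph \<Rightarrow> bool" where
  "ic_planar G \<longleftrightarrow> (\<exists>pos c. ic_planar_drawing G pos c)"

end

theory Submission
  imports Defs
begin

text \<open>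
  Nest infinitely many copies of one block of eight vertices, each copy scaled by \<open>13\<close> with respect
  to the previous one. A block consists of an inner quadrilateral \<open>u\<^sub>0u\<^sub>1u\<^sub>2u\<^sub>3\<close> and an outer one
  \<open>v\<^sub>0v\<^sub>1v\<^sub>2v\<^sub>3\<close>, the four edges \<open>u\<^sub>iv\<^sub>i\<close>, and the two further edges \<open>u\<^sub>0v\<^sub>2\<close>, which crosses \<open>u\<^sub>1v\<^sub>1\<close>, and
  \<open>u\<^sub>2v\<^sub>0\<close>, which crosses \<open>u\<^sub>3v\<^sub>3\<close>. These two crossings use each of the eight vertices once. Four edges
  join \<open>v\<^sub>i\<close> to the vertex \<open>u\<^sub>i\<close> of the next block. With \<open>K\<close> blocks there are \<open>8K\<close> vertices and
  \<open>14K + 4(K - 1) = 2.25 \<cdot> 8K - 4\<close> edges. All edges are straight, and the norm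
  \<open>\<bar>x\<bar> + 4\<bar>y\<bar>\<close>, whose balls are the inner quadrilaterals, separates the blocks from each other, so that
  planarity reduces to finitely many orientation tests inside one block.
\<close>

section \<open>Straight segments in the plane\<close>

definition det2 :: "complex \<Rightarrow> complex \<Rightarrow> real" where
  "det2 u v = Re u * Im v - Im u * Re v"

lemma open_segmentD:
  fixes a b z :: complex
  assumes "z \<in> open_segment a b"
  obtains s where "0 < s" "s < 1" "z = a + s *\<^sub>R (b - a)" "a \<noteq> b"
  using assms unfolding in_segment by (metis add.commute add_diff_eq diff_add_eq scaleR_collapse
      scaleR_diff_right scaleR_left_diff_distrib scaleR_one)

lemma det2_open_segment:
  assumes "z \<in> open_segment a b"
  shows "det2 (b - a) (z - a) = 0"
proof -
  obtain s where "z = a + s *\<^sub>R (b - a)" using open_segmentD[OF assms] by metis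
  then have "z - a = s *\<^sub>R (b - a)" by simp
  then show ?thesis by (simp only: det2_def scaleR_complex.sel) simp
qed

text \<open>Orientation with respect to the line through \<open>a\<close> and \<open>b\<close> is
  affine along \<open>c d\<close>; with weakly equal signs at the ends and one of them nonzero, it
  cannot vanish strictly between. Allowing one zero covers edges that share an endpoint.\<close>

lemma disjoint_open_segments:
  assumes "0 \<le> det2 (b - a) (c - a) * det2 (b - a) (d - a)"
    and "det2 (b - a) (c - a) \<noteq> 0 \<or> det2 (b - a) (d - a) \<noteq> 0"
  shows "open_segment a b \<inter> open_segment c d = {}"
proof -
  have False if z: "z \<in> open_segment a b" "z \<in> open_segment c d" for z
  proof -
    let ?\<alpha> = "det2 (b - a) (c - a)" and ?\<beta> = "det2 (b - a) (d - a)"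
    obtain t where t: "0 < t" "t < 1" "z = c + t *\<^sub>R (d - c)"
      using open_segmentD[OF z(2)] by metis
    have "det2 (b - a) (z - a) = (1 - t) * ?\<alpha> + t * ?\<beta>"
      by (simp add: t(3) det2_def algebra_simps)
    then have eq: "(1 - t) * ?\<alpha> + t * ?\<beta> = 0" using det2_open_segment[OF z(1)] by simp
    have "?\<alpha> \<ge> 0 \<and> ?\<beta> \<ge> 0 \<or> ?\<alpha> \<le> 0 \<and> ?\<beta> \<le> 0"
      using assms(1) by (simp add: zero_le_mult_iff)
    then show False
    proof
      assume p: "?\<alpha> \<ge> 0 \<and> ?\<beta> \<ge> 0"
      then have "(1 - t) * ?\<alpha> \<ge> 0" "t * ?\<beta> \<ge> 0" using t by auto
      with eq have "(1 - t) * ?\<alpha> = 0" "t * ?\<beta> = 0" by linarith+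
      then show False using assms(2) t by auto
    next
      assume p: "?\<alpha> \<le> 0 \<and> ?\<beta> \<le> 0"
      then have "(1 - t) * ?\<alpha> \<le> 0" "t * ?\<beta> \<le> 0" using t by (auto simp: mult_le_0_iff)
      with eq have "(1 - t) * ?\<alpha> = 0" "t * ?\<beta> = 0" by linarith+
      then show False using assms(2) t by auto
    qed
  qed
  then show ?thesis by blast
qed

text \<open>The difference of two common points is parallel to both directions, which are
  independent.\<close>

lemma open_segments_unique_common_point:
  assumes "det2 (b - a) (d - c) \<noteq> 0"
    and "p \<in> open_segment a b \<inter> open_segment c d" "q \<in> open_segment a b \<inter> open_segment c d"
  shows "p = q"
proof -
  obtain s s' where s: "p = a + s *\<^sub>R (b - a)" "q = a + s' *\<^sub>R (b - a)"
    using assms(2,3) open_segmentD by (metis IntD1)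
  obtain t t' where t: "p = c + t *\<^sub>R (d - c)" "q = c + t' *\<^sub>R (d - c)"
    using assms(2,3) open_segmentD by (metis IntD2)
  have e1: "p - q = (s - s') *\<^sub>R (b - a)" unfolding s by (simp add: algebra_simps)
  have e2: "p - q = (t - t') *\<^sub>R (d - c)" unfolding t by (simp add: algebra_simps)
  have "det2 (p - q) (d - c) = (s - s') * det2 (b - a) (d - c)"
    unfolding e1 by (simp add: det2_def algebra_simps)
  moreover have "det2 (p - q) (d - c) = 0"
    unfolding e2 by (simp add: det2_def algebra_simps)
  ultimately have "s = s'" using assms(1) by simp
  then show ?thesis using s by simp
qed

lemma arc_interior_linepath:
  "arc_interior (linepath a b) = open_segment a b"
  by (simp add: arc_interior_def open_segment_def)

text \<open>The chart consists of the affine coordinates centred at \<open>p\<close> along the two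
  segment directions, rescaled so that the unit ball does not see the endpoints.\<close>

lemma cross_at_linepath:
  assumes det: "det2 (b - a) (d - c) \<noteq> 0"
    and p: "p \<in> open_segment a b" "p \<in> open_segment c d"
  shows "cross_at (linepath a b) (linepath c d) p"
proof -
  define u v D where "u = b - a" and "v = d - c" and "D = det2 u v"
  have D: "D \<noteq> 0" using det by (simp add: D_def u_def v_def)
  obtain s where s: "0 < s" "s < 1" "p = a + s *\<^sub>R u"
    using open_segmentD[OF p(1)] unfolding u_def by metis
  obtain t where t: "0 < t" "t < 1" "p = c + t *\<^sub>R v"
    using open_segmentD[OF p(2)] unfolding v_def by metis
  \<comment> \<open>Along its segment, \<open>p\<close> has parameter distance at least
    \<open>e\<close> from every endpoint, so each axis inside the unit ball is the image of a piece
    of the corresponding segment.\<close>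
  define e where "e = min (min s (1 - s)) (min t (1 - t))"
  have e: "e > 0" "e \<le> s" "e \<le> 1 - s" "e \<le> t" "e \<le> 1 - t"
    using s t by (auto simp: e_def)
  define \<psi> where "\<psi> w = p + (e * Re w) *\<^sub>R u + (e * Im w) *\<^sub>R v" for w
  \<comment> \<open>Cramer's rule, inverting \<psi>.\<close>
  define \<phi> where "\<phi> z = Complex (det2 (z - p) v / (e * D)) (det2 u (z - p) / (e * D))" for z
  have \<phi>\<psi>: "\<phi> (\<psi> w) = w" for w
  proof -
    have "det2 (\<psi> w - p) v = e * Re w * D" "det2 u (\<psi> w - p) = e * Im w * D"
      by (simp_all add: \<psi>_def D_def det2_def algebra_simps)
    then show ?thesis using D e by (simp add: \<phi>_def complex_eq_iff)
  qed
  have \<psi>\<phi>: "\<psi> (\<phi> z) = z" for z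
  proof -
    have "\<psi> (\<phi> z) = p + (det2 (z - p) v / D) *\<^sub>R u + (det2 u (z - p) / D) *\<^sub>R v"
      using e by (simp add: \<psi>_def \<phi>_def)
    moreover have "(det2 (z - p) v / D) *\<^sub>R u + (det2 u (z - p) / D) *\<^sub>R v = z - p"
    proof -
      have "det2 (z - p) v * Re u + det2 u (z - p) * Re v = D * Re (z - p)"
        "det2 (z - p) v * Im u + det2 u (z - p) * Im v = D * Im (z - p)"
        by (simp_all add: D_def det2_def algebra_simps)
      then show ?thesis using D by (simp add: complex_eq_iff field_simps)
    qed
    ultimately show ?thesis by (simp add: add.assoc)
  qed
  have c\<psi>: "continuous_on S \<psi>" for S
    unfolding \<psi>_def by (intro continuous_intros)
  have c\<phi>: "continuous_on S \<phi>" for S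
    unfolding \<phi>_def det2_def Complex_eq by (intro continuous_intros) (use D e in auto)
  define U where "U = \<phi> -` ball 0 1"
  have U: "open U" unfolding U_def
    using c\<phi>[of UNIV] by (intro open_vimage) auto
  have \<phi>p: "\<phi> p = 0" by (simp add: \<phi>_def det2_def complex_eq_iff)
  have hom: "homeomorphism U (ball 0 1) \<phi> \<psi>"
    unfolding homeomorphism_def using c\<psi> c\<phi> \<phi>\<psi> \<psi>\<phi>
    by (auto simp: U_def image_iff) (metis \<phi>\<psi> dist_0_norm mem_ball)+
  have im1: "\<phi> ` (U \<inter> path_image (linepath a b)) = {z \<in> ball 0 1. Im z = 0}"
  proof (intro equalityI subsetI)
    fix w assume "w \<in> \<phi> ` (U \<inter> path_image (linepath a b))"
    then obtain z where z: "w = \<phi> z" "z \<in> U" "z \<in> closed_segment a b" by auto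
    then obtain r where "z = (1 - r) *\<^sub>R a + r *\<^sub>R b" unfolding in_segment by auto
    then have "z - p = (r - s) *\<^sub>R u" by (simp add: s u_def algebra_simps)
    then have "det2 u (z - p) = 0" by (simp add: det2_def)
    then show "w \<in> {z \<in> ball 0 1. Im z = 0}" using z by (simp add: U_def \<phi>_def)
  next
    fix w :: complex assume w: "w \<in> {z \<in> ball 0 1. Im z = 0}"
    have "\<bar>Re w\<bar> \<le> 1" using w abs_Re_le_cmod[of w] by simp
    then have "\<bar>e * Re w\<bar> \<le> e" using e by (simp add: abs_mult)
    then have r: "0 \<le> s + e * Re w" "s + e * Re w \<le> 1" using e by auto
    have "\<psi> w = (1 - (s + e * Re w)) *\<^sub>R a + (s + e * Re w) *\<^sub>R b"
      using w by (simp add: \<psi>_def s u_def algebra_simps)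
    then have "\<psi> w \<in> closed_segment a b" unfolding in_segment using r by blast
    moreover have "\<psi> w \<in> U" using w by (simp add: U_def \<phi>\<psi>)
    ultimately show "w \<in> \<phi> ` (U \<inter> path_image (linepath a b))"
      using \<phi>\<psi>[of w] by (metis IntI image_eqI path_image_linepath)
  qed
  have im2: "\<phi> ` (U \<inter> path_image (linepath c d)) = {z \<in> ball 0 1. Re z = 0}"
  proof (intro equalityI subsetI)
    fix w assume "w \<in> \<phi> ` (U \<inter> path_image (linepath c d))"
    then obtain z where z: "w = \<phi> z" "z \<in> U" "z \<in> closed_segment c d" by auto
    then obtain r where "z = (1 - r) *\<^sub>R c + r *\<^sub>R d" unfolding in_segment by auto
    then have "z - p = (r - t) *\<^sub>R v" by (simp add: t u_def v_def algebra_simps)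
    then have "det2 (z - p) v = 0" by (simp add: det2_def)
    then show "w \<in> {z \<in> ball 0 1. Re z = 0}" using z by (simp add: U_def \<phi>_def)
  next
    fix w :: complex assume w: "w \<in> {z \<in> ball 0 1. Re z = 0}"
    have "\<bar>Im w\<bar> \<le> 1" using w abs_Im_le_cmod[of w] by simp
    then have "\<bar>e * Im w\<bar> \<le> e" using e by (simp add: abs_mult)
    then have r: "0 \<le> t + e * Im w" "t + e * Im w \<le> 1" using e by auto
    have "\<psi> w = (1 - (t + e * Im w)) *\<^sub>R c + (t + e * Im w) *\<^sub>R d"
      using w by (simp add: \<psi>_def t v_def algebra_simps)
    then have "\<psi> w \<in> closed_segment c d" unfolding in_segment using r by blast
    moreover have "\<psi> w \<in> U" using w by (simp add: U_def \<phi>\<psi>)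
    ultimately show "w \<in> \<phi> ` (U \<inter> path_image (linepath c d))"
      using \<phi>\<psi>[of w] by (metis IntI image_eqI path_image_linepath)
  qed
  have "p \<in> U" using \<phi>p by (simp add: U_def)
  then show ?thesis
    unfolding cross_at_def arc_interior_linepath
    using p U hom \<phi>p im1 im2 by blast
qed

section \<open>The weighted norm that measures the nesting depth\<close>

definition rnorm :: "complex \<Rightarrow> real" where
  "rnorm z = \<bar>Re z\<bar> + 4 * \<bar>Im z\<bar>"

lemma rnorm_scaleR: "rnorm (r *\<^sub>R z) = \<bar>r\<bar> * rnorm z"
  by (simp add: rnorm_def abs_mult algebra_simps)

text \<open>Convexity of balls. Strictness is asked at one end only because a linking edge ends
  exactly on the boundary of the ball.\<close>

lemma rnorm_open_segment_less:
  assumes "z \<in> open_segment a b" "rnorm a < r" "rnorm b \<le> r"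
  shows "rnorm z < r"
proof -
  obtain s where s: "0 < s" "s < 1" "z = a + s *\<^sub>R (b - a)"
    using open_segmentD[OF assms(1)] by metis
  then have z: "Re z = (1 - s) * Re a + s * Re b" "Im z = (1 - s) * Im a + s * Im b"
    by (simp_all add: s(3) algebra_simps)
  have "\<bar>Re z\<bar> \<le> (1 - s) * \<bar>Re a\<bar> + s * \<bar>Re b\<bar>" "\<bar>Im z\<bar> \<le> (1 - s) * \<bar>Im a\<bar> + s * \<bar>Im b\<bar>"
    unfolding z using s by (metis abs_mult abs_of_pos abs_triangle_ineq diff_gt_0_iff_gt)+
  then have "rnorm z \<le> (1 - s) * rnorm a + s * rnorm b"
    by (simp add: rnorm_def algebra_simps)
  also have "\<dots> < (1 - s) * r + s * r"
    using s assms(2,3) by (intro add_less_le_mono) auto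
  finally show ?thesis by (simp add: algebra_simps)
qed

text \<open>The complement of a ball is not convex, so the segment is kept in a half-plane outside
  the ball. The bounds on \<alpha> and \<beta> say that the functional is at most
  \<open>2 * rnorm\<close>; the factor 2 leaves room for integer coefficients in every functional
  chosen later.\<close>

lemma rnorm_open_segment_ge:
  assumes "z \<in> open_segment a b" "\<bar>\<alpha>\<bar> \<le> 2" "\<bar>\<beta>\<bar> \<le> 8"
    and "\<alpha> * Re a + \<beta> * Im a \<ge> 2 * r" "\<alpha> * Re b + \<beta> * Im b \<ge> 2 * r"
  shows "rnorm z \<ge> r"
proof -
  obtain s where s: "0 < s" "s < 1" "z = a + s *\<^sub>R (b - a)"
    using open_segmentD[OF assms(1)] by metis
  have "2 * r = (1 - s) * (2 * r) + s * (2 * r)" by (simp add: algebra_simps)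
  also have "\<dots> \<le> (1 - s) * (\<alpha> * Re a + \<beta> * Im a) + s * (\<alpha> * Re b + \<beta> * Im b)"
    using s assms(4,5) by (intro add_mono mult_left_mono) auto
  also have "\<dots> = \<alpha> * Re z + \<beta> * Im z" by (simp add: s algebra_simps)
  also have "\<dots> \<le> \<bar>\<alpha>\<bar> * \<bar>Re z\<bar> + \<bar>\<beta>\<bar> * \<bar>Im z\<bar>"
    by (metis abs_ge_self abs_mult add_mono)
  also have "\<dots> \<le> 2 * \<bar>Re z\<bar> + 8 * \<bar>Im z\<bar>"
    using assms(2,3) by (intro add_mono mult_right_mono) auto
  finally show ?thesis by (simp add: rnorm_def)
qed

section \<open>One block\<close>

text \<open>
  The vertices \<open>u\<^sub>0, u\<^sub>1, u\<^sub>2, u\<^sub>3, v\<^sub>3, v\<^sub>0, v\<^sub>1, v\<^sub>2\<close> of a block are numbered \<open>0, \<dots>, 7\<close>, and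
  \<open>8, \<dots>, 11\<close> are \<open>u\<^sub>0, u\<^sub>1, u\<^sub>2, u\<^sub>3\<close> of the next block. The shift in the numbering of the \<open>v\<^sub>i\<close>
  makes the parity of the number a proper 2-colouring.
\<close>

definition block_points :: "(int \<times> int) list" where
  "block_points =
     [(-4, 0), (0, 1), (4, 0), (0, -1), (-1, -12), (-8, -6), (1, 12), (8, 6),
      (-52, 0), (0, 13), (52, 0), (0, -13)]"

definition inner_edges :: "(nat \<times> nat) list" where
  "inner_edges =
     [(0,1), (1,2), (2,3), (0,3), (4,5), (5,6), (6,7), (4,7),
      (0,5), (1,6), (2,7), (3,4), (0,7), (2,5)]"

definition linking_edges :: "(nat \<times> nat) list" where
  "linking_edges = [(5,8), (6,9), (7,10), (4,11)]"

definition block_edges :: "(nat \<times> nat) list" where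
  "block_edges = inner_edges @ linking_edges"

text \<open>Each crossing is listed in both orders, since its two edges may be met in either
  order.\<close>

definition block_crossings :: "((nat \<times> nat) \<times> nat \<times> nat) list" where
  "block_crossings = [((0,7),(1,6)), ((1,6),(0,7)), ((2,5),(3,4)), ((3,4),(2,5))]"

section \<open>Exact integer tests on one block\<close>

fun idet :: "int \<times> int \<Rightarrow> int \<times> int \<Rightarrow> int \<times> int \<Rightarrow> int \<times> int \<Rightarrow> int" where
  "idet (a, a') (b, b') (c, c') (d, d') = (b - a) * (d' - c') - (b' - a') * (d - c)"

definition orient :: "nat \<times> nat \<Rightarrow> nat \<Rightarrow> int" where
  "orient p k =
     (let a = block_points ! fst p; b = block_points ! snd p; c = block_points ! k
      in idet a b a c)"

text \<open>Integer form of the hypotheses of \<open>disjoint_open_segments\<close>. It is not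
  symmetric: the line through \<open>p\<close> separates, so the check below tries both
  orders.\<close>

definition separated :: "nat \<times> nat \<Rightarrow> nat \<times> nat \<Rightarrow> bool" where
  "separated p q \<longleftrightarrow>
     0 \<le> orient p (fst q) * orient p (snd q) \<and> (orient p (fst q) \<noteq> 0 \<or> orient p (snd q) \<noteq> 0)"

fun inorm :: "int \<times> int \<Rightarrow> int" where
  "inorm (x, y) = \<bar>x\<bar> + 4 * \<bar>y\<bar>"

fun ifun :: "int \<times> int \<Rightarrow> int \<times> int \<Rightarrow> int" where
  "ifun (a, b) (x, y) = a * x + b * y"

lemma block_check_separated:
  "\<forall>p \<in> set block_edges. \<forall>q \<in> set block_edges.
     p = q \<or> (p, q) \<in> set block_crossings \<or> separated p q \<or> separated q p"
  by code_simp

text \<open>The numbers from 8 on may be left out: those vertices belong to the next block and are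
  kept off the open segments by their norm.\<close>

lemma block_check_vertices:
  "\<forall>p \<in> set block_edges. \<forall>k \<in> set [0..<8]. k = fst p \<or> k = snd p \<or> orient p k \<noteq> 0"
  by code_simp

lemma block_check_crossings:
  "\<forall>(p, q) \<in> set block_crossings. p \<in> set block_edges \<and> q \<in> set block_edges \<and>
     idet (block_points ! fst p) (block_points ! snd p) (block_points ! fst q) (block_points ! snd q) \<noteq> 0"
  by code_simp

text \<open>As 52 = 13 * 4, the half-open shell of one block ends exactly where that of the next
  begins.\<close>

lemma block_check_norm:
  "\<forall>k \<in> set [0..<8]. 4 \<le> inorm (block_points ! k) \<and> inorm (block_points ! k) < 52"
  by code_simp

lemma block_check_next:
  "\<forall>k \<in> set [0..<4]. block_points ! (8 + k) =
     (13 * fst (block_points ! k), 13 * snd (block_points ! k))"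
  by code_simp

text \<open>
  The functionals are the normals of the sides of the inner quadrilateral and, for the sides
  \<open>v\<^sub>0v\<^sub>1\<close> and \<open>v\<^sub>2v\<^sub>3\<close>, which do not lie beyond any single one of these, two intermediate ones.
\<close>

lemma block_check_functional:
  "\<forall>p \<in> set block_edges. \<exists>f \<in> set [(2, 8), (2, -8), (-2, 8), (-2, -8), (-2, 1), (2, -1)].
     8 \<le> ifun f (block_points ! fst p) \<and> 8 \<le> ifun f (block_points ! snd p)"
  by code_simp

lemma block_check_indices:
  "\<forall>p \<in> set block_edges. fst p < 8 \<and> snd p < 12 \<and> fst p < snd p \<and> odd (fst p + snd p)"
  by code_simp

lemma block_check_distinct: "distinct (take 8 block_points)"
  by code_simp

definition block_point :: "nat \<Rightarrow> complex" where
  "block_point k = (case block_points ! k of (x, y) \<Rightarrow> Complex (of_int x) (of_int y))"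

text \<open>Scaling multiplies determinants by a square, so the signs found for integer coordinates
  hold in every block.\<close>

lemma det2_block_points:
  "det2 (r *\<^sub>R block_point b - r *\<^sub>R block_point a) (r *\<^sub>R block_point d - r *\<^sub>R block_point c) =
     r\<^sup>2 * of_int (idet (block_points ! a) (block_points ! b) (block_points ! c) (block_points ! d))"
  by (simp add: det2_def block_point_def power2_eq_square algebra_simps split: prod.split)

lemma orient_idet:
  "orient p k = idet (block_points ! fst p) (block_points ! snd p) (block_points ! fst p) (block_points ! k)"
  by (simp add: orient_def Let_def)

lemma rnorm_block_point: "rnorm (block_point k) = of_int (inorm (block_points ! k))"
  by (simp add: rnorm_def block_point_def split: prod.split)

section \<open>The nested blocks\<close>

definition vpos :: "nat \<Rightarrow> complex" where
  "vpos n = 13 ^ (n div 8) *\<^sub>R block_point (n mod 8)"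

text \<open>For \<open>k\<close> from 8 to 11 the number \<open>8 * m + k\<close> overflows into
  block \<open>m + 1\<close>, whose scale has one more factor 13; \<open>block_points\<close>
  contains that factor already. Linking edges thus need no separate treatment.\<close>

lemma vpos_block:
  assumes "k < 12"
  shows "vpos (8 * m + k) = 13 ^ m *\<^sub>R block_point k"
proof (cases "k < 8")
  case True
  then show ?thesis by (simp add: vpos_def)
next
  case False
  define i where "i = k - 8"
  have k: "k = 8 + i" "i < 4" using False assms by (auto simp: i_def)
  have "block_points ! (8 + i) = (13 * fst (block_points ! i), 13 * snd (block_points ! i))"
    using block_check_next k(2) by simp
  then have "block_point (8 + i) = 13 *\<^sub>R block_point i"
    by (simp add: block_point_def complex_eq_iff split: prod.split)
  moreover have "(8 * m + (8 + i)) div 8 = Suc m" "(8 * m + (8 + i)) mod 8 = i"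
    using k(2) by presburger+
  ultimately show ?thesis unfolding k(1) vpos_def by simp
qed

text \<open>Shells with different indices are disjoint, so the norm of a point determines its
  block.\<close>

lemma level_unique:
  fixes x :: real
  assumes "4 * 13 ^ m \<le> x" "x < 52 * 13 ^ m" "4 * 13 ^ n \<le> x" "x < 52 * 13 ^ n"
  shows "m = n"
proof -
  have "(13::real) ^ m < 13 ^ Suc n" "(13::real) ^ n < 13 ^ Suc m" using assms by auto
  then have "m < Suc n" "n < Suc m" by (simp_all only: power_strict_increasing_iff)
  then show ?thesis by simp
qed

lemma rnorm_vpos:
  "4 * 13 ^ (n div 8) \<le> rnorm (vpos n)" "rnorm (vpos n) < 52 * 13 ^ (n div 8)"
proof -
  have "4 \<le> inorm (block_points ! (n mod 8)) \<and> inorm (block_points ! (n mod 8)) < 52"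
    using block_check_norm by simp
  then have "4 \<le> rnorm (block_point (n mod 8))" "rnorm (block_point (n mod 8)) < 52"
    unfolding rnorm_block_point by linarith+
  then show "4 * 13 ^ (n div 8) \<le> rnorm (vpos n)" "rnorm (vpos n) < 52 * 13 ^ (n div 8)"
    by (simp_all add: vpos_def rnorm_scaleR)
qed

lemma inj_vpos: "inj vpos"
proof (rule injI)
  fix i j assume eq: "vpos i = vpos j"
  have lev: "i div 8 = j div 8"
    using rnorm_vpos[of i] rnorm_vpos[of j] level_unique unfolding eq by blast
  then have "block_point (i mod 8) = block_point (j mod 8)" using eq by (simp add: vpos_def)
  then have "block_points ! (i mod 8) = block_points ! (j mod 8)"
    by (simp add: block_point_def split: prod.splits)
  then have "take 8 block_points ! (i mod 8) = take 8 block_points ! (j mod 8)" by simp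
  then have "i mod 8 = j mod 8"
    by (subst (asm) nth_eq_iff_index_eq[OF block_check_distinct]) (auto simp: block_points_def)
  with lev show "i = j" by (metis div_mult_mod_eq)
qed

section \<open>Edges as segments in disjoint shells\<close>

definition edge_at :: "nat \<Rightarrow> nat \<times> nat \<Rightarrow> nat set" where
  "edge_at m p = {8 * m + fst p, 8 * m + snd p}"

definition segment_at :: "nat \<Rightarrow> nat \<times> nat \<Rightarrow> complex set" where
  "segment_at m p = open_segment (vpos (8 * m + fst p)) (vpos (8 * m + snd p))"

lemma block_edgesD:
  assumes "p \<in> set block_edges"
  shows "fst p < 8" "snd p < 12" "fst p < snd p" "odd (fst p + snd p)"
  using block_check_indices assms by blast+

lemma segment_at_scaled:
  assumes "p \<in> set block_edges"
  shows "segment_at m p = open_segment (13 ^ m *\<^sub>R block_point (fst p)) (13 ^ m *\<^sub>R block_point (snd p))"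
  using block_edgesD[OF assms] by (simp add: segment_at_def vpos_block)

lemma rnorm_segment_at:
  assumes p: "p \<in> set block_edges" and z: "z \<in> segment_at m p"
  shows "4 * 13 ^ m \<le> rnorm z" "rnorm z < 52 * 13 ^ m"
proof -
  note [simp] = block_edgesD[OF p]
  have "rnorm (vpos (8 * m + fst p)) < 52 * 13 ^ m"
    using rnorm_vpos(2)[of "8 * m + fst p"] by simp
  \<comment> \<open>Equality occurs at the outer ends of the linking edges, which lie on the first
    sphere of the next shell.\<close>
  moreover have "rnorm (vpos (8 * m + snd p)) \<le> 52 * 13 ^ m"
  proof -
    have "\<forall>k \<in> set [0..<12]. inorm (block_points ! k) \<le> 52" by code_simp
    then have "rnorm (block_point (snd p)) \<le> 52" by (simp add: rnorm_block_point)
    then show ?thesis by (simp add: vpos_block rnorm_scaleR)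
  qed
  ultimately show "rnorm z < 52 * 13 ^ m"
    using z rnorm_open_segment_less unfolding segment_at_def by blast
  obtain f where f: "f \<in> set [(2, 8), (2, -8), (-2, 8), (-2, -8), (-2, 1), (2, -1)]"
      "8 \<le> ifun f (block_points ! fst p)" "8 \<le> ifun f (block_points ! snd p)"
    using block_check_functional p by blast
  have f': "\<bar>real_of_int (fst f)\<bar> \<le> 2" "\<bar>real_of_int (snd f)\<bar> \<le> 8" using f(1) by auto
  have ge: "fst f * Re (13 ^ m *\<^sub>R block_point k) + snd f * Im (13 ^ m *\<^sub>R block_point k)
      \<ge> 2 * (4 * 13 ^ m)" if "8 \<le> ifun f (block_points ! k)" for k
  proof -
    have "fst f * Re (13 ^ m *\<^sub>R block_point k) + snd f * Im (13 ^ m *\<^sub>R block_point k) =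
        13 ^ m * real_of_int (ifun f (block_points ! k))"
      by (cases f) (simp add: block_point_def algebra_simps split: prod.split)
    moreover have "13 ^ m * 8 \<le> 13 ^ m * real_of_int (ifun f (block_points ! k))"
      using that by (intro mult_left_mono) auto
    ultimately show ?thesis by linarith
  qed
  show "4 * 13 ^ m \<le> rnorm z"
    using rnorm_open_segment_ge[OF _ f' ge[OF f(2)] ge[OF f(3)]] z
    unfolding segment_at_scaled[OF p] by blast
qed

lemma separated_disjoint:
  assumes "p \<in> set block_edges" "q \<in> set block_edges" "separated p q"
  shows "segment_at m p \<inter> segment_at m q = {}"
  unfolding segment_at_scaled[OF assms(1)] segment_at_scaled[OF assms(2)]
proof (rule disjoint_open_segments, goal_cases)
  case 1
  have "0 \<le> real_of_int (orient p (fst q) * orient p (snd q))"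
    using assms(3) unfolding separated_def of_int_0_le_iff by blast
  \<comment> \<open>Each of the two determinants contributes one factor
    \<open>(13 ^ m)\<^sup>2\<close>.\<close>
  then have "0 \<le> ((13 ^ m)\<^sup>2 * (13 ^ m)\<^sup>2) * real_of_int (orient p (fst q) * orient p (snd q))"
    by (intro mult_nonneg_nonneg) auto
  then show ?case unfolding det2_block_points orient_idet[symmetric] by (simp add: mult_ac)
next
  case 2
  then show ?case unfolding det2_block_points orient_idet[symmetric]
    using assms(3) by (simp add: separated_def)
qed

text \<open>A common point has one norm, which forces both edges into the same block; there the
  finite check decides.\<close>

lemma segments_meet_only_at_crossings:
  assumes p: "p \<in> set block_edges" and q: "q \<in> set block_edges"
    and z: "z \<in> segment_at m p" "z \<in> segment_at n q"
    and ne: "edge_at m p \<noteq> edge_at n q"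
  shows "m = n \<and> (p, q) \<in> set block_crossings"
proof -
  have mn: "m = n"
    using level_unique rnorm_segment_at[OF p z(1)] rnorm_segment_at[OF q z(2)] by blast
  have "\<not> separated p q" "\<not> separated q p"
    using separated_disjoint p q z mn by blast+
  moreover have "p \<noteq> q" using ne mn by auto
  ultimately show ?thesis using block_check_separated p q mn by blast
qed

lemma vpos_in_segment_at:
  assumes p: "p \<in> set block_edges" and z: "vpos v \<in> segment_at m p"
  shows "v \<in> edge_at m p"
proof -
  have m: "v div 8 = m"
    using level_unique rnorm_segment_at[OF p z] rnorm_vpos[of v] by blast
  define k where "k = v mod 8"
  have v: "v = 8 * m + k" "k < 8" using m by (auto simp: k_def)
  have "vpos v = 13 ^ m *\<^sub>R block_point k" using vpos_block[of k m] v by simp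
  then have "real_of_int (orient p k) = 0"
    using det2_open_segment[OF z[unfolded segment_at_scaled[OF p]]] det2_block_points
    by (simp add: orient_idet)
  then have "orient p k = 0" by simp
  moreover have "k \<in> set [0..<8]" using v(2) by simp
  ultimately have "k = fst p \<or> k = snd p" using block_check_vertices p by blast
  then show ?thesis using v by (auto simp: edge_at_def)
qed

section \<open>The straight-line drawing\<close>

definition curve :: "nat set \<Rightarrow> real \<Rightarrow> complex" where
  "curve e = linepath (vpos (Min e)) (vpos (Max e))"

text \<open>An edge is only a set, but every listed pair is increasing, so \<open>Min\<close> and
  \<open>Max\<close> recover its endpoints in order.\<close>

lemma curve_edge_at:
  assumes "p \<in> set block_edges"
  shows "curve (edge_at m p) = linepath (vpos (8 * m + fst p)) (vpos (8 * m + snd p))"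
  using block_edgesD(3)[OF assms] by (simp add: curve_def edge_at_def)

lemma arc_interior_curve:
  assumes "p \<in> set block_edges"
  shows "arc_interior (curve (edge_at m p)) = segment_at m p"
  by (simp add: curve_edge_at[OF assms] arc_interior_linepath segment_at_def)

lemma block_crossing_transversal:
  assumes "(p, q) \<in> set block_crossings"
  shows "det2 (vpos (8 * m + snd p) - vpos (8 * m + fst p)) (vpos (8 * m + snd q) - vpos (8 * m + fst q)) \<noteq> 0"
proof -
  have pq: "p \<in> set block_edges" "q \<in> set block_edges" using block_check_crossings assms by auto
  note [simp] = block_edgesD[OF pq(1)] block_edgesD[OF pq(2)]
  have "fst p < 12" "fst q < 12" using block_edgesD(1)[OF pq(1)] block_edgesD(1)[OF pq(2)] by linarith+
  then show ?thesis using block_check_crossings assms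
    by (auto simp: vpos_block det2_block_points)
qed

text \<open>Crossed edges only use numbers below 8, so division by 8 of a shared vertex gives back
  its block and its number there. The rest is a check on the four listed pairs.\<close>

lemma block_crossings_independent:
  assumes "(p, q) \<in> set block_crossings" "(p', q') \<in> set block_crossings"
    and "(edge_at m p \<union> edge_at m q) \<inter> (edge_at n p' \<union> edge_at n q') \<noteq> {}"
  shows "m = n \<and> {p, q} = {p', q'}"
proof -
  have lt: "\<forall>(p, q) \<in> set block_crossings. fst p < 8 \<and> snd p < 8 \<and> fst q < 8 \<and> snd q < 8"
    by code_simp
  obtain x where x: "x \<in> edge_at m p \<union> edge_at m q" "x \<in> edge_at n p' \<union> edge_at n q'"
    using assms(3) by blast
  obtain i where i: "x = 8 * m + i" "i \<in> {fst p, snd p, fst q, snd q}"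
    using x(1) by (auto simp: edge_at_def)
  obtain j where j: "x = 8 * n + j" "j \<in> {fst p', snd p', fst q', snd q'}"
    using x(2) by (auto simp: edge_at_def)
  have "i < 8" "j < 8" using lt assms(1,2) i(2) j(2) by auto
  then have "m = n" "i = j" using i(1) j(1) by presburger+
  then have "m = n \<and> {fst p, snd p, fst q, snd q} \<inter> {fst p', snd p', fst q', snd q'} \<noteq> {}"
    using i(2) j(2) by blast
  moreover have "\<forall>(p, q) \<in> set block_crossings. \<forall>(p', q') \<in> set block_crossings.
      {fst p, snd p, fst q, snd q} \<inter> {fst p', snd p', fst q', snd q'} = {} \<or> {p, q} = {p', q'}"
    by code_simp
  ultimately show ?thesis using assms(1,2) by fast
qed

lemma block_crossings_functional:
  assumes "(p, q) \<in> set block_crossings" "(p, q') \<in> set block_crossings"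
  shows "q = q'"
  using assms by (auto simp: block_crossings_def)

text \<open>The whole infinite system of blocks is drawn once by \<open>vpos\<close> and
  \<open>curve\<close>; every graph using only its edges inherits the drawing.\<close>

lemma ic_planar_if_block_edges:
  fixes G :: "nat graph"
  assumes E: "edges G \<subseteq> {edge_at m p | m p. p \<in> set block_edges}"
  shows "ic_planar G"
proof -
  have ex: "\<exists>m p. e = edge_at m p \<and> p \<in> set block_edges" if "e \<in> edges G" for e
    using E that by blast
  have meet: "\<exists>m p q. e = edge_at m p \<and> f = edge_at m q \<and> (p, q) \<in> set block_crossings \<and>
      p \<in> set block_edges \<and> q \<in> set block_edges \<and> z \<in> segment_at m p \<and> z \<in> segment_at m q"
    if ef: "e \<in> edges G" "f \<in> edges G" "e \<noteq> f" "z \<in> arc_interior (curve e) \<inter> arc_interior (curve f)"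
    for e f z
  proof -
    obtain m p n q where e: "e = edge_at m p" "f = edge_at n q"
        "p \<in> set block_edges" "q \<in> set block_edges"
      using ex ef by metis
    then have z: "z \<in> segment_at m p" "z \<in> segment_at n q"
      using ef(4) by (simp_all add: arc_interior_curve)
    then have "m = n \<and> (p, q) \<in> set block_crossings"
      using segments_meet_only_at_crossings[OF e(3,4)] e(1,2) ef(3) by blast
    then show ?thesis using e z by blast
  qed
  have cross: "p \<in> arc_interior (curve e) \<inter> arc_interior (curve f)"
    if "cross_at (curve e) (curve f) p" for e f p
    using that by (simp add: cross_at_def)
  have pair: "\<exists>m p q. e = edge_at m p \<and> f = edge_at m q \<and> (p, q) \<in> set block_crossings"
    if "crossing_pair G curve e f" for e f
    using that meet cross unfolding crossing_pair_def by metis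
  have "drawing G vpos curve"
    unfolding drawing_def
  proof (intro conjI ballI impI allI)
    show "inj_on vpos (verts G)" using inj_vpos by (meson inj_on_subset subset_UNIV)
  next
    fix e assume "e \<in> edges G"
    then obtain m p where e: "e = edge_at m p" "p \<in> set block_edges" using ex by blast
    have "vpos (8 * m + fst p) \<noteq> vpos (8 * m + snd p)"
      using block_edgesD(3)[OF e(2)] inj_vpos by (auto dest: injD)
    then show "arc (curve e)" by (simp add: e curve_edge_at arc_linepath)
    show "{pathstart (curve e), pathfinish (curve e)} = vpos ` e"
      by (simp add: e curve_edge_at) (simp add: edge_at_def)
  next
    fix e v assume "e \<in> edges G" and v: "vpos v \<in> path_image (curve e)"
    then obtain m p where e: "e = edge_at m p" "p \<in> set block_edges" using ex by blast
    then have "vpos v \<in> segment_at m p \<or> vpos v = vpos (8 * m + fst p) \<or> vpos v = vpos (8 * m + snd p)"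
      using v by (auto simp: curve_edge_at segment_at_def open_segment_def)
    then show "v \<in> e" using vpos_in_segment_at[OF e(2)] inj_vpos
      by (auto simp: e edge_at_def dest: injD)
  next
    fix e f assume ef: "e \<in> edges G" "f \<in> edges G" "e \<noteq> f \<and> e \<inter> f \<noteq> {}"
    show "\<nexists>p. cross_at (curve e) (curve f) p"
    proof
      assume "\<exists>p. cross_at (curve e) (curve f) p"
      then obtain m p q where "e = edge_at m p" "f = edge_at m q" "(p, q) \<in> set block_crossings"
        using meet cross ef by metis
      \<comment> \<open>The edges of a listed crossing have no common endpoint.\<close>
      then show False using ef(3) by (auto simp: block_crossings_def edge_at_def)
    qed
  next
    fix e f z assume ef: "e \<in> edges G" "f \<in> edges G" "e \<noteq> f"
      and z: "z \<in> arc_interior (curve e) \<inter> arc_interior (curve f)"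
    obtain m p q where "e = edge_at m p" "f = edge_at m q" "(p, q) \<in> set block_crossings"
      "p \<in> set block_edges" "q \<in> set block_edges" "z \<in> segment_at m p" "z \<in> segment_at m q"
      using meet[OF ef z] by blast
    then show "cross_at (curve e) (curve f) z"
      using cross_at_linepath[OF block_crossing_transversal] by (simp add: curve_edge_at segment_at_def)
  next
    fix e f z w assume ef: "e \<in> edges G" "f \<in> edges G" "e \<noteq> f"
      and zw: "cross_at (curve e) (curve f) z \<and> cross_at (curve e) (curve f) w"
    obtain m p q where e: "e = edge_at m p" "f = edge_at m q" "(p, q) \<in> set block_crossings"
      "p \<in> set block_edges" "q \<in> set block_edges"
      using meet[OF ef] cross zw by metis
    then have "z \<in> segment_at m p \<inter> segment_at m q" "w \<in> segment_at m p \<inter> segment_at m q"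
      using cross zw by (metis arc_interior_curve)+
    then show "z = w"
      using open_segments_unique_common_point[OF block_crossing_transversal[OF e(3)]]
      unfolding segment_at_def by blast
  qed
  moreover have "f = f'" if cp: "crossing_pair G curve e f \<and> crossing_pair G curve e f'" for e f f'
  proof -
    obtain m p q where 1: "e = edge_at m p" "f = edge_at m q" "(p, q) \<in> set block_crossings"
      using cp pair by blast
    obtain n p' q' where 2: "e = edge_at n p'" "f' = edge_at n q'" "(p', q') \<in> set block_crossings"
      using cp pair by blast
    have "(edge_at m p \<union> edge_at m q) \<inter> (edge_at n p' \<union> edge_at n q') \<noteq> {}"
      using 1 2 by (auto simp: edge_at_def)
    then have "m = n" "{p, q} = {p', q'}"
      using block_crossings_independent[OF 1(3) 2(3)] by auto
    \<comment> \<open>The crossings agree so far only as unordered pairs. If they were swapped,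
      \<open>e\<close> would equal the edge that it crosses.\<close>
    moreover have "p = p'"
    proof (rule ccontr)
      assume "p \<noteq> p'"
      with \<open>{p, q} = {p', q'}\<close> have "p' = q" by (metis insert_iff singletonD)
      then show False using 1(1,3) 2(1) \<open>m = n\<close> by (auto simp: edge_at_def block_crossings_def)
    qed
    ultimately show ?thesis using 1 2 block_crossings_functional by blast
  qed
  moreover have "(e \<union> f) \<inter> (e' \<union> f') = {}"
    if cp: "crossing_pair G curve e f \<and> crossing_pair G curve e' f' \<and> {e, f} \<noteq> {e', f'}" for e f e' f'
  proof (rule ccontr)
    assume ne: "(e \<union> f) \<inter> (e' \<union> f') \<noteq> {}"
    obtain m p q where 1: "e = edge_at m p" "f = edge_at m q" "(p, q) \<in> set block_crossings"
      using cp pair by blast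
    obtain n p' q' where 2: "e' = edge_at n p'" "f' = edge_at n q'" "(p', q') \<in> set block_crossings"
      using cp pair by blast
    have "m = n" "{p, q} = {p', q'}"
      using block_crossings_independent[OF 1(3) 2(3)] ne 1 2 by auto
    then have "edge_at m ` {p, q} = edge_at n ` {p', q'}" by simp
    then show False using cp 1 2 by simp
  qed
  ultimately show ?thesis unfolding ic_planar_def ic_planar_drawing_def by blast
qed

section \<open>The family of graphs\<close>

text \<open>The outermost block has no successor, hence one fewer set of linking edges than blocks.
  Indices are kept instead of edges so that counting becomes a matter of products.\<close>

definition edge_index :: "nat \<Rightarrow> (nat \<times> nat \<times> nat) set" where
  "edge_index k = {..<Suc k} \<times> set inner_edges \<union> {..<k} \<times> set linking_edges"

text \<open>\<open>nested k\<close> consists of \<open>k + 1\<close> blocks.\<close>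

definition nested :: "nat \<Rightarrow> nat graph" where
  "nested k = ({..<8 * Suc k}, (\<lambda>(m, p). edge_at m p) ` edge_index k)"

lemma edge_indexD: "(m, p) \<in> edge_index k \<Longrightarrow> p \<in> set block_edges"
  by (auto simp: edge_index_def block_edges_def)

text \<open>The smaller endpoint is \<open>8 * m + i\<close> with \<open>i < 8\<close>, so it
  determines the block and then both numbers.\<close>

lemma inj_on_edge_index: "inj_on (\<lambda>(m, p). edge_at m p) (edge_index k)"
proof (rule inj_onI, clarify)
  fix m i j n i' j'
  assume "(m, i, j) \<in> edge_index k" "(n, i', j') \<in> edge_index k"
    and eq: "edge_at m (i, j) = edge_at n (i', j')"
  then have b: "i < 8" "i < j" "i' < 8" "i' < j'"
    using block_edgesD[of "(i, j)"] block_edgesD[of "(i', j')"] edge_indexD by auto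
  from eq have "8 * m + i = 8 * n + i' \<and> 8 * m + j = 8 * n + j'"
    using b by (auto simp: edge_at_def doubleton_eq_iff)
  moreover from this have "m = n" using b by presburger
  ultimately show "m = n \<and> (i, j) = (i', j')" by simp
qed

lemma card_edges_nested: "card (edges (nested k)) = 18 * k + 14"
proof -
  have "card (edges (nested k)) = card (edge_index k)"
    unfolding nested_def by (simp add: card_image[OF inj_on_edge_index])
  also have "\<dots> = card ({..<Suc k} \<times> set inner_edges) + card ({..<k} \<times> set linking_edges)"
    unfolding edge_index_def
    by (rule card_Un_disjoint) (auto simp: inner_edges_def linking_edges_def)
  also have "card (set inner_edges) = 14" "card (set linking_edges) = 4"
    by (simp_all add: inner_edges_def linking_edges_def)
  ultimately show ?thesis by (simp add: card_cartesian_product)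
qed

lemma edge_at_subset_nested:
  assumes "(m, p) \<in> edge_index k"
  shows "edge_at m p \<subseteq> verts (nested k)"
proof -
  \<comment> \<open>A linking edge reaches at most one block further, and such an edge starts in a
    block other than the last.\<close>
  have "m < Suc k \<and> fst p < 8 \<and> snd p < 8 \<or> m < k \<and> fst p < 16 \<and> snd p < 16"
    using assms by (auto simp: edge_index_def inner_edges_def linking_edges_def)
  then show ?thesis by (auto simp: edge_at_def nested_def)
qed

lemma simple_graph_nested: "simple_graph (nested k)"
  unfolding simple_graph_def
proof (intro conjI ballI)
  show "finite (verts (nested k))" by (simp add: nested_def)
next
  fix e assume "e \<in> edges (nested k)"
  then obtain m p where e: "(m, p) \<in> edge_index k" "e = edge_at m p"
    by (auto simp: nested_def)
  then show "e \<subseteq> verts (nested k)" using edge_at_subset_nested by blast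
  show "card e = 2" using block_edgesD(3)[OF edge_indexD[OF e(1)]] by (simp add: e edge_at_def)
qed

text \<open>Adding \<open>8 * m\<close> preserves parity, so the colouring of one block by parity
  extends to all of them.\<close>

lemma bipartite_nested: "bipartite (nested k)"
  unfolding bipartite_def
proof (intro exI conjI ballI)
  let ?A = "{v \<in> verts (nested k). even v}" and ?B = "{v \<in> verts (nested k). odd v}"
  show "?A \<inter> ?B = {}" "?A \<union> ?B = verts (nested k)" by auto
  fix e assume "e \<in> edges (nested k)"
  then obtain m p where e: "(m, p) \<in> edge_index k" "e = edge_at m p"
    by (auto simp: nested_def)
  have sub: "8 * m + fst p \<in> verts (nested k)" "8 * m + snd p \<in> verts (nested k)"
    using edge_at_subset_nested[OF e(1)] by (auto simp: edge_at_def)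
  have odd: "odd (fst p + snd p)" using block_edgesD(4) edge_indexD e(1) by blast
  show "\<exists>a \<in> ?A. \<exists>b \<in> ?B. e = {a, b}"
  proof (cases "even (fst p)")
    case True
    then show ?thesis using sub odd e(2)
      by (intro bexI[of _ "8 * m + fst p"] bexI[of _ "8 * m + snd p"]) (auto simp: edge_at_def)
  next
    case False
    then show ?thesis using sub odd e(2)
      by (intro bexI[of _ "8 * m + snd p"] bexI[of _ "8 * m + fst p"]) (auto simp: edge_at_def)
  qed
qed

lemma ic_planar_nested: "ic_planar (nested k)"
  by (rule ic_planar_if_block_edges) (auto simp: nested_def dest: edge_indexD)

text \<open>The number of vertices already distinguishes the members of the family.\<close>

lemma graph_iso_nestedD: "graph_iso (nested k) (nested l) \<Longrightarrow> k = l"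
  unfolding graph_iso_def by (auto simp: nested_def dest: bij_betw_same_card)

theorem theorem1:
  "\<exists>S :: nat graph set.
     infinite S \<and>
     pairwise (\<lambda>G H. \<not> graph_iso G H) S \<and>
     (\<forall>G \<in> S. simple_graph G \<and> bipartite G \<and> ic_planar G \<and>
        real (card (edges G)) = 2.25 * real (card (verts G)) - 4)"
proof (intro exI conjI ballI)
  have "inj nested" by (rule injI) (auto simp: nested_def)
  then show "infinite (range nested)" by (simp add: range_inj_infinite)
  show "pairwise (\<lambda>G H. \<not> graph_iso G H) (range nested)"
    by (auto simp: pairwise_def dest: graph_iso_nestedD)
  fix G assume "G \<in> range nested"
  then obtain k where G: "G = nested k" by blast
  show "simple_graph G" "bipartite G" "ic_planar G"
    using simple_graph_nested bipartite_nested ic_planar_nested G by auto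
  have "card (verts G) = 8 * Suc k" by (simp add: G nested_def)
  \<comment> \<open>Both sides equal \<open>18 * k + 14\<close>, as 2.25 * 8 = 18.\<close>
  then show "real (card (edges G)) = 2.25 * real (card (verts G)) - 4"
    by (simp add: G card_edges_nested)
qed

end
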